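(* Let $r\ge 2$ be an integer and let $f$ be the sequence defined by $f(0)=0$, $f(1)=1$ and $f(n)=r f(n-1)+f(n-2)$ for $n\ge 2$. Let $N>0$ be an integer. There is no integer $C$ such that for every integer $n\ge 0$ there exists an integer index $j\ge 0$ (depending on $n$ and $N$) with $$\sum_{i=0}^{4N+1} f(n+i) = C\cdot f(j).$$ *)

theory Defs
  imports Main
begin

fun rfib :: "int \<Rightarrow> nat \<Rightarrow> int" where
  "rfib r 0 = 0"
| "rfib r (Suc 0) = 1"
| "rfib r (Suc (Suc n)) = r * rfib r (Suc n) + rfib r n"

end

theory Submission
  imports Defs
begin

text \<open>
  The sum over \<open>4N + 2\<close> consecutive terms is symmetric about its middle, and \<open>f(c - k) + f(c + k)\<close>
  is a multiple of \<open>f(c)\<close>, independent of \<open>c\<close>, for even \<open>k\<close>; so the sum equals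
  \<open>D * (f(m) + f(m+1))\<close> with \<open>m = n + 2N\<close> and a constant \<open>D > 0\<close>. Suppose this is \<open>C * f(j)\<close>. Comparing
  growth rates, the index \<open>j\<close> increases by exactly 1 when \<open>n\<close> does. As consecutive values are
  coprime both for \<open>f(m)\<close> and for \<open>f(m) + f(m+1)\<close>, taking gcds gives \<open>C = D\<close>, hence
  \<open>f(j) = f(m) + f(m+1)\<close>, which lies strictly between \<open>f(m+1)\<close> and \<open>f(m+2)\<close>.
\<close>

text \<open>The multiplier is a^(2e) + b^(2e), where a and b are the roots of x^2 = r x + 1. The
  induction builds it by the recurrence for every second term, with coefficients r^2 + 2 and
  -1.\<close>

lemma rfib_symmetric_sum: "\<exists>p. \<forall>n. rfib r n + rfib r (n + 4 * e) = p * rfib r (n + 2 * e)"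
proof (induction e rule: induct_nat_012)
  case 0
  show ?case by (intro exI[of _ 2]) simp
next
  case 1
  show ?case
    by (intro exI[of _ "r\<^sup>2 + 2"])
      (simp add: numeral_eq_Suc algebra_simps)
next
  case (ge2 e)
  then obtain p q where p: "\<And>n. rfib r n + rfib r (n + 4 * e) = p * rfib r (n + 2 * e)"
    and q: "\<And>n. rfib r n + rfib r (n + 4 * Suc e) = q * rfib r (n + 2 * Suc e)"
    by blast
  have step: "rfib r n + rfib r (n + 4) = (r\<^sup>2 + 2) * rfib r (n + 2)" for n
    by (simp add: numeral_eq_Suc algebra_simps)
  show ?case
  proof (intro exI[of _ "(r\<^sup>2 + 2) * q - p"] allI)
    fix n
    \<comment> \<open>Add \<open>step\<close> at both ends, \<open>n\<close> and
      \<open>n + 4 + 4 * e\<close>, and regroup into symmetric pairs about the same centre.\<close>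
    have "rfib r n + rfib r (n + 4 * Suc (Suc e))
        = (r\<^sup>2 + 2) * (rfib r (n + 2) + rfib r (n + 2 + 4 * Suc e))
          - (rfib r (n + 4) + rfib r (n + 4 + 4 * e))"
      using step[of n] step[of "n + 4 + 4 * e"] by (simp add: algebra_simps)
    also have "\<dots> = ((r\<^sup>2 + 2) * q - p) * rfib r (n + 2 * Suc (Suc e))"
    proof -
      have "n + 4 + 2 * e = n + 2 * Suc (Suc e)" "n + 2 + 2 * Suc e = n + 2 * Suc (Suc e)"
        by simp_all
      thus ?thesis unfolding p q by (simp only: left_diff_distrib mult.assoc)
    qed
    finally show "rfib r n + rfib r (n + 4 * Suc (Suc e))
        = ((r\<^sup>2 + 2) * q - p) * rfib r (n + 2 * Suc (Suc e))" .
  qed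
qed

text \<open>Passing from \<open>N\<close> to \<open>Suc N\<close> puts two terms at each end of the
  window that starts at \<open>n + 2\<close>. They form two symmetric pairs, about the two middle
  indices, with the same multiplier \<open>p\<close>.\<close>

lemma sum_rfib:
  "\<exists>D. \<forall>n. (\<Sum>i = 0..4 * N + 1. rfib r (n + i)) = D * (rfib r (n + 2 * N) + rfib r (n + 2 * N + 1))"
proof (induction N)
  case 0
  show ?case by (intro exI[of _ 1]) simp
next
  case (Suc N)
  then obtain D where D: "\<And>n. (\<Sum>i = 0..4 * N + 1. rfib r (n + i))
      = D * (rfib r (n + 2 * N) + rfib r (n + 2 * N + 1))"
    by blast
  obtain p where p: "\<And>n. rfib r n + rfib r (n + 4 * Suc N) = p * rfib r (n + 2 * Suc N)"
    using rfib_symmetric_sum by blast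
  show ?case
  proof (intro exI[of _ "D + p"] allI)
    fix n
    have "(\<Sum>i = 0..4 * Suc N + 1. rfib r (n + i))
        = rfib r n + rfib r (n + 1) + (\<Sum>i = 2..4 * N + 3. rfib r (n + i))
          + rfib r (n + 4 * Suc N) + rfib r (n + 1 + 4 * Suc N)"
      by (simp add: sum.atLeast_Suc_atMost numeral_eq_Suc)
    also have "(\<Sum>i = 2..4 * N + 3. rfib r (n + i)) = (\<Sum>i = 0..4 * N + 1. rfib r (n + 2 + i))"
      using sum.shift_bounds_cl_nat_ivl[of "\<lambda>i. rfib r (n + i)" 0 2 "4 * N + 1"]
      by (simp add: algebra_simps numeral_eq_Suc)
    finally show "(\<Sum>i = 0..4 * Suc N + 1. rfib r (n + i))
        = (D + p) * (rfib r (n + 2 * Suc N) + rfib r (n + 2 * Suc N + 1))"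
      using D[of "n + 2"] p[of n] p[of "n + 1"] by (simp add: algebra_simps)
  qed
qed

lemma rfib_nonneg: "r \<ge> 0 \<Longrightarrow> rfib r n \<ge> 0"
  by (induction r n rule: rfib.induct) auto

lemma rfib_Suc_ge: "r \<ge> 0 \<Longrightarrow> r * rfib r n \<le> rfib r (Suc n)"
  by (cases n) (auto simp: rfib_nonneg)

lemma rfib_le_Suc: "r \<ge> 1 \<Longrightarrow> rfib r n \<le> rfib r (Suc n)"
  using rfib_Suc_ge[of r n] rfib_nonneg[of r n] mult_right_mono[of 1 r "rfib r n"] by simp

lemma rfib_mono: "r \<ge> 1 \<Longrightarrow> m \<le> n \<Longrightarrow> rfib r m \<le> rfib r n"
  by (rule lift_Suc_mono_le) (auto intro: rfib_le_Suc)

lemma rfib_pos: "r \<ge> 1 \<Longrightarrow> n > 0 \<Longrightarrow> rfib r n > 0"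
  using rfib_mono[of r 1 n] by simp

lemma coprime_rfib_Suc: "coprime (rfib r n) (rfib r (Suc n))"
proof (induction n)
  case (Suc n)
  have "gcd (rfib r (Suc n)) (rfib r (Suc (Suc n))) = gcd (rfib r (Suc n)) (rfib r n)"
    using gcd_add_mult[of "rfib r (Suc n)" r "rfib r n"] by (simp add: add.commute)
  with Suc show ?case by (simp add: coprime_iff_gcd_eq_1 gcd.commute)
qed simp

text \<open>These sums obey the recurrence of \<open>rfib\<close> and start with 1, so the Euclidean
  step applies again.\<close>

lemma coprime_rfib_add_Suc:
  "coprime (rfib r n + rfib r (Suc n)) (rfib r (Suc n) + rfib r (Suc (Suc n)))"
proof (induction n)
  case (Suc n)
  let ?g = "\<lambda>n. rfib r n + rfib r (Suc n)"
  have "?g (Suc (Suc n)) = r * ?g (Suc n) + ?g n"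
    by (simp add: algebra_simps)
  hence "gcd (?g (Suc n)) (?g (Suc (Suc n))) = gcd (?g (Suc n)) (?g n)"
    by (metis gcd_add_mult)
  with Suc show ?case by (simp add: coprime_iff_gcd_eq_1 gcd.commute del: rfib.simps)
qed simp

text \<open>By monotonicity the lower bound forces j' > j, while f(j+2) = r f(j+1) + f(j) \<ge>
  (r+1) f(j) forces j' < j + 2.\<close>

lemma rfib_index_Suc:
  assumes "r \<ge> 2" and "r * rfib r j < rfib r j'" and "rfib r j' < (r + 1) * rfib r j"
  shows "j' = Suc j"
proof -
  have nonneg: "rfib r j \<ge> 0" using assms(1) by (simp add: rfib_nonneg)
  have "j < j'"
  proof (rule ccontr)
    assume "\<not> j < j'"
    hence "rfib r j' \<le> rfib r j" using assms(1) by (simp add: rfib_mono)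
    also have "\<dots> \<le> r * rfib r j" using mult_right_mono[of 1 r] assms(1) nonneg by simp
    finally show False using assms(2) by simp
  qed
  moreover have "j' < Suc (Suc j)"
  proof (rule ccontr)
    assume "\<not> j' < Suc (Suc j)"
    hence "rfib r (Suc (Suc j)) \<le> rfib r j'" using assms(1) by (intro rfib_mono) auto
    moreover have "r * rfib r j \<le> r * rfib r (Suc j)"
      using assms(1) rfib_le_Suc[of r j] by (intro mult_left_mono) auto
    ultimately show False using assms(3) by (simp add: algebra_simps)
  qed
  ultimately show ?thesis by simp
qed

lemma rfib_neq_add_Suc:
  assumes "r \<ge> 2" and "m > 0"
  shows "rfib r j \<noteq> rfib r m + rfib r (Suc m)"
proof
  assume eq: "rfib r j = rfib r m + rfib r (Suc m)"
  have pos: "rfib r m > 0" "rfib r (Suc m) > 0" using assms by (simp_all add: rfib_pos)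
  \<comment> \<open>For r = 1 the sum would be f(m+2) itself.\<close>
  have "2 * rfib r (Suc m) \<le> r * rfib r (Suc m)"
    using assms(1) pos by (intro mult_right_mono) auto
  hence upper: "rfib r j < rfib r (Suc (Suc m))" using eq pos by simp
  show False
  proof (cases "j \<le> Suc m")
    case True
    thus False using rfib_mono[OF _ True, of r] assms(1) eq pos by simp
  next
    case False
    hence "rfib r (Suc (Suc m)) \<le> rfib r j" using assms(1) by (intro rfib_mono) auto
    with upper show False by simp
  qed
qed

theorem theorem4p2:
  fixes r :: int and N :: nat
  assumes "r \<ge> 2" and "N > 0"
  shows "\<not> (\<exists>C::int. \<forall>n::nat. \<exists>j::nat. (\<Sum>i = 0..4 * N + 1. rfib r (n + i)) = C * rfib r j)"
proof
  assume "\<exists>C::int. \<forall>n::nat. \<exists>j::nat. (\<Sum>i = 0..4 * N + 1. rfib r (n + i)) = C * rfib r j"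
  then obtain C where C: "\<And>n. \<exists>j. (\<Sum>i = 0..4 * N + 1. rfib r (n + i)) = C * rfib r j"
    by blast
  obtain D where D: "\<And>n. (\<Sum>i = 0..4 * N + 1. rfib r (n + i))
      = D * (rfib r (n + 2 * N) + rfib r (n + 2 * N + 1))"
    using sum_rfib by blast
  define g where "g m = rfib r m + rfib r (Suc m)" for m
  \<comment> \<open>Only the windows starting at 1 and 2 are used; \<open>m\<close> is the lower
    middle index of the first, which avoids f(0) = 0.\<close>
  define m where "m = 2 * N + 1"
  have pos: "rfib r k > 0" if "k > 0" for k
    using assms(1) that by (simp add: rfib_pos)
  have g_pos: "g k > 0" for k
    using pos[of "Suc k"] rfib_nonneg[of r k] assms(1) by (simp add: g_def)
  obtain j where j: "D * g m = C * rfib r j"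
    using C[of 1] D[of 1] by (auto simp: g_def m_def)
  obtain j' where j': "D * g (Suc m) = C * rfib r j'"
    using C[of 2] D[of 2] by (auto simp: g_def m_def simp del: rfib.simps)
  have "(\<Sum>i = 0..4 * N + 1. rfib r (1 + i)) > 0"
    by (intro sum_pos pos) auto
  hence "D * g m > 0"
    unfolding D by (simp add: g_def m_def)
  hence "D > 0" using g_pos[of m] by (simp add: zero_less_mult_iff)
  have "C > 0"
    using \<open>D * g m > 0\<close> j rfib_nonneg[of r j] assms(1) by (auto simp: zero_less_mult_iff)
  have g_Suc: "g (Suc m) = r * g m + g (2 * N)"
    by (simp add: g_def m_def algebra_simps)
  \<comment> \<open>The difference is r f(m). Hence g(m+1) lies strictly between r g(m) and (r+1)
    g(m).\<close>
  have "g (2 * N) < g m"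
    using assms(1) pos[of m] by (simp add: g_def m_def zero_less_mult_iff)
  hence "D * (r * g m) < D * g (Suc m)" "D * g (Suc m) < D * ((r + 1) * g m)"
    using \<open>D > 0\<close> g_pos[of "2 * N"] g_Suc by (simp_all add: algebra_simps)
  moreover have "D * (s * g m) = C * (s * rfib r j)" for s
    using j by (simp add: algebra_simps)
  ultimately have "r * rfib r j < rfib r j'" "rfib r j' < (r + 1) * rfib r j"
    using \<open>C > 0\<close> j' by (simp_all only: mult_less_cancel_left_pos)
  hence "j' = Suc j" using assms(1) by (intro rfib_index_Suc)
  \<comment> \<open>By coprimality the left side is \<open>D\<close> and the right side is
    \<open>C\<close>, both being positive.\<close>
  hence "gcd (D * g m) (D * g (Suc m)) = gcd (C * rfib r j) (C * rfib r (Suc j))"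
    using j j' by simp
  moreover have "gcd (g m) (g (Suc m)) = 1"
    using coprime_rfib_add_Suc unfolding g_def by (simp only: coprime_iff_gcd_eq_1)
  moreover have "gcd (rfib r j) (rfib r (Suc j)) = 1"
    using coprime_rfib_Suc by (simp only: coprime_iff_gcd_eq_1)
  ultimately have "C = D"
    using \<open>C > 0\<close> \<open>D > 0\<close> by (simp add: gcd_mult_distrib_int[symmetric] del: rfib.simps)
  hence "rfib r j = g m" using j \<open>D > 0\<close> by simp
  thus False
    using rfib_neq_add_Suc[OF assms(1), of m j] by (simp add: g_def m_def)
qed

end
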